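(* Consider the 2-element subsets $\Pi\subseteq S_3$ with $\Pi\neq\{123,321\}$, and call two such subsets $\Pi,\Pi'$ ch-Wilf equivalent if $Ch_n(\Pi;q)=Ch_n(\Pi';q)$ for all $n\ge0$. Then the ch-Wilf equivalence class of $\{132,213\}$ among these subsets is $\{\{132,213\},\{213,312\},\{132,231\},\{231,312\}\}$, and every other such subset is ch-Wilf equivalent to no other such subset (its class contains only itself).
   Context: $S_n$ is the set of permutations of $[n]$ in one-line notation. A permutation $\pi$ avoids $\sigma$ if no subsequence of $\pi$ is order isomorphic to $\sigma$; for a set $\Pi$ of permutations, $Av_n(\Pi)$ is the set of permutations in $S_n$ avoiding every element of $\Pi$. For $\pi\in S_n$, the charge value of $i\in[n]$ is: $chv(1)=0$; for $i\ge2$, $chv(i)=0$ if $i$ is to the right of $i-1$ in $\pi$ and $chv(i)=n+1-i$ if $i$ is to the left of $i-1$ in $\pi$; the charge is $ch(\pi)=\sum_{i=1}^n chv(i)$. Define $Ch_n(\Pi;q)=\sum_{\sigma\in Av_n(\Pi)} q^{ch(\sigma)}$. *)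

theory Defs
  imports
    "HOL-Combinatorics.Multiset_Permutations"
    "HOL-Computational_Algebra.Polynomial"
    "HOL-Library.Sublist"
begin

text \<open>A permutation in \<open>S\<^sub>n\<close> is represented by its one-line notation: a list in which each of
  \<open>1, \<dots>, n\<close> occurs exactly once.\<close>

definition perms :: "nat \<Rightarrow> nat list set" where
  "perms n = permutations_of_set {1..n}"

definition order_isomorphic :: "nat list \<Rightarrow> nat list \<Rightarrow> bool" where
  "order_isomorphic xs ys \<longleftrightarrow>
     length xs = length ys \<and>
     (\<forall>i<length xs. \<forall>j<length xs. xs ! i < xs ! j \<longleftrightarrow> ys ! i < ys ! j)"

text \<open>\<^const>\<open>subseq\<close> is the library's notion of a not necessarily contiguous subsequence.\<close>

definition avoids :: "nat list \<Rightarrow> nat list \<Rightarrow> bool" where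
  "avoids p s \<longleftrightarrow> \<not> (\<exists>t. subseq t p \<and> order_isomorphic t s)"

definition Av :: "nat \<Rightarrow> nat list set \<Rightarrow> nat list set" where
  "Av n P = {p \<in> perms n. \<forall>s\<in>P. avoids p s}"

definition left_of :: "nat list \<Rightarrow> nat \<Rightarrow> nat \<Rightarrow> bool" where
  "left_of p a b \<longleftrightarrow> (\<exists>i j. i < j \<and> j < length p \<and> p ! i = a \<and> p ! j = b)"

text \<open>For \<open>p\<close> in \<open>perms n\<close> we have \<open>length p = n\<close>. The natural-number subtractions below are
  only relevant for \<open>2 \<le> i \<le> n\<close>, where they do not truncate.\<close>

definition chv :: "nat list \<Rightarrow> nat \<Rightarrow> nat" where
  "chv p i = (if 2 \<le> i \<and> left_of p i (i - 1) then length p + 1 - i else 0)"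

definition charge :: "nat list \<Rightarrow> nat" where
  "charge p = (\<Sum>i=1..length p. chv p i)"

definition Ch :: "nat \<Rightarrow> nat list set \<Rightarrow> int poly" where
  "Ch n P = (\<Sum>p\<in>Av n P. monom 1 (charge p))"

definition pattern_pairs :: "nat list set set" where
  "pattern_pairs = {P. P \<subseteq> perms 3 \<and> card P = 2 \<and> P \<noteq> {[1,2,3], [3,2,1]}}"

definition ch_wilf :: "(nat list set \<times> nat list set) set" where
  "ch_wilf = {(P, Q). P \<in> pattern_pairs \<and> Q \<in> pattern_pairs \<and> (\<forall>n. Ch n P = Ch n Q)}"

end

theory Submission
  imports Defs
begin

text \<open>For each of the four pairs in the class, a permutation avoiding the pair arises from one on the
  larger values by inserting a new minimum \<open>k\<close>, and exactly two insertions are allowed: one puts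
  \<open>k\<close> to the left of the previous minimum \<open>k + 1\<close>, which leaves the charge unchanged, and one puts
  it to the right, which adds \<open>n - k\<close>. Hence all four charge polynomials equal
  \<open>(1 + q) (1 + q\<^sup>2) \<dots> (1 + q\<^bsup>n-1\<^esup>)\<close>. The remaining pairs are separated from these and from each
  other by the value of \<open>Ch 4 P\<close> at \<open>q = 2\<close>.\<close>

section \<open>Charge and pattern avoidance in terms of subsequences\<close>

text \<open>Replaces positions by \<open>subseq\<close>, which recurses along the list and so suits
  both induction and evaluation by the simplifier.\<close>

lemma left_of_iff_subseq: "left_of p a b \<longleftrightarrow> subseq [a, b] p"
proof (induction p)
  case Nil
  then show ?case by (simp add: left_of_def)
next
  case (Cons x p)
  have "left_of (x # p) a b \<longleftrightarrow> (x = a \<and> b \<in> set p) \<or> left_of p a b"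
  proof
    assume "left_of (x # p) a b"
    then obtain i j where ij: "i < j" "j < length (x # p)" "(x # p) ! i = a" "(x # p) ! j = b"
      unfolding left_of_def by blast
    then obtain j' where "j = Suc j'" by (cases j) auto
    with ij show "(x = a \<and> b \<in> set p) \<or> left_of p a b"
      by (cases i) (auto simp: left_of_def)
  next
    assume "(x = a \<and> b \<in> set p) \<or> left_of p a b"
    then show "left_of (x # p) a b"
    proof
      assume "x = a \<and> b \<in> set p"
      then obtain j where "j < length p" "p ! j = b" by (auto simp: in_set_conv_nth)
      then show ?thesis using \<open>x = a \<and> b \<in> set p\<close> unfolding left_of_def
        by (intro exI[of _ 0] exI[of _ "Suc j"]) auto
    next
      assume "left_of p a b"
      then obtain i j where "i < j" "j < length p" "p ! i = a" "p ! j = b"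
        unfolding left_of_def by blast
      then show ?thesis unfolding left_of_def
        by (intro exI[of _ "Suc i"] exI[of _ "Suc j"]) auto
    qed
  qed
  then show ?case using Cons
    by (cases "x = a") (auto simp: subseq_singleton_left dest: subseq_Cons')
qed

lemma charge_eq: "charge p = (\<Sum>i=2..length p. if subseq [i, i - 1] p then length p + 1 - i else 0)"
  unfolding charge_def chv_def left_of_iff_subseq
  by (rule sum.mono_neutral_cong_right) auto

text \<open>The ternary analogue of \<open>sorted_wrt\<close>. Its recursion makes avoidance of a
  pattern of length 3 computable on concrete lists and easy to follow through an insertion.\<close>

fun sorted_wrt3 :: "('a \<Rightarrow> 'a \<Rightarrow> 'a \<Rightarrow> bool) \<Rightarrow> 'a list \<Rightarrow> bool" where
  "sorted_wrt3 R [] \<longleftrightarrow> True"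
| "sorted_wrt3 R (x # xs) \<longleftrightarrow> sorted_wrt (R x) xs \<and> sorted_wrt3 R xs"

text \<open>If \<open>x = a\<close>, then a match that skips \<open>a\<close> also gives a match of
  \<open>xs\<close> in \<open>p\<close>, so the disjunction agrees with the greedy choice in
  \<open>subseq_Cons2_iff\<close>. It is used in place of that simp rule because it avoids the case
  split on \<open>x = a\<close>.\<close>

lemma subseq_Cons_Cons_iff:
  "subseq (x # xs) (a # p) \<longleftrightarrow> x = a \<and> subseq xs p \<or> subseq (x # xs) p"
  by (cases "x = a") (auto dest: subseq_Cons')

lemma subseq_pair_set: "subseq [a, b] p \<Longrightarrow> a \<in> set p \<and> b \<in> set p"
  by (induction p) (auto simp: subseq_singleton_left subseq_Cons_Cons_iff simp del: subseq_Cons2_iff)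

lemma sorted_wrt_iff_subseq: "sorted_wrt R p \<longleftrightarrow> (\<forall>x y. subseq [x, y] p \<longrightarrow> R x y)"
  by (induction p) (auto simp: subseq_singleton_left subseq_Cons_Cons_iff simp del: subseq_Cons2_iff)

lemma sorted_wrt3_iff_subseq:
  "sorted_wrt3 R p \<longleftrightarrow> (\<forall>x y z. subseq [x, y, z] p \<longrightarrow> R x y z)"
  by (induction p) (auto simp: sorted_wrt_iff_subseq subseq_Cons_Cons_iff simp del: subseq_Cons2_iff)

text \<open>An occurrence of a pattern of length 3 has exactly three entries, so quantifying over
  subsequences amounts to quantifying over triples.\<close>

lemma avoids_iff_sorted_wrt3:
  "avoids p [a, b, c] \<longleftrightarrow> sorted_wrt3 (\<lambda>x y z. \<not> order_isomorphic [x, y, z] [a, b, c]) p"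
  unfolding avoids_def sorted_wrt3_iff_subseq
proof (safe, goal_cases)
  case (2 t)
  from \<open>order_isomorphic t [a, b, c]\<close> have "length t = 3" by (simp add: order_isomorphic_def)
  then obtain x y z where "t = [x, y, z]" by (auto simp: numeral_eq_Suc length_Suc_conv)
  with 2 show ?case by blast
qed blast

lemma order_isomorphic_perms3:
  "order_isomorphic [x, y, z] [1, 2, 3] \<longleftrightarrow> x < y \<and> y < z"
  "order_isomorphic [x, y, z] [1, 3, 2] \<longleftrightarrow> x < z \<and> z < y"
  "order_isomorphic [x, y, z] [2, 1, 3] \<longleftrightarrow> y < x \<and> x < z"
  "order_isomorphic [x, y, z] [2, 3, 1] \<longleftrightarrow> z < x \<and> x < y"
  "order_isomorphic [x, y, z] [3, 1, 2] \<longleftrightarrow> y < z \<and> z < x"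
  "order_isomorphic [x, y, z] [3, 2, 1] \<longleftrightarrow> z < y \<and> y < x"
  by (auto simp: order_isomorphic_def All_less_Suc)

lemma avoids_perms3:
  "avoids p [1, 2, 3] \<longleftrightarrow> sorted_wrt3 (\<lambda>x y z. \<not> (x < y \<and> y < z)) p"
  "avoids p [1, 3, 2] \<longleftrightarrow> sorted_wrt3 (\<lambda>x y z. \<not> (x < z \<and> z < y)) p"
  "avoids p [2, 1, 3] \<longleftrightarrow> sorted_wrt3 (\<lambda>x y z. \<not> (y < x \<and> x < z)) p"
  "avoids p [2, 3, 1] \<longleftrightarrow> sorted_wrt3 (\<lambda>x y z. \<not> (z < x \<and> x < y)) p"
  "avoids p [3, 1, 2] \<longleftrightarrow> sorted_wrt3 (\<lambda>x y z. \<not> (y < z \<and> z < x)) p"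
  "avoids p [3, 2, 1] \<longleftrightarrow> sorted_wrt3 (\<lambda>x y z. \<not> (z < y \<and> y < x)) p"
  by (simp_all only: avoids_iff_sorted_wrt3 order_isomorphic_perms3)

section \<open>Evaluating the charge polynomial for n = 4\<close>

lemma permutations_of_set_4:
  "permutations_of_set {1..4::nat} = set (permutations_of_set_list [1, 2, 3, 4])"
proof -
  have "{1..4} = set [1, 2, 3, 4::nat]" by auto
  then show ?thesis by (simp only: permutations_of_list) simp
qed

lemma charge_four:
  assumes "length p = 4"
  shows "charge p = (if subseq [2, 1] p then 3 else 0) + (if subseq [3, 2] p then 2 else 0) +
    (if subseq [4, 3] p then 1 else 0)"
  using assms
  by (simp add: charge_eq numeral_eq_Suc)

lemma poly_Ch: "poly (Ch n P) x = (\<Sum>p\<in>Av n P. x ^ charge p)"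
  by (simp add: Ch_def poly_sum poly_monom)

text \<open>Turns the sum over a set into a sum over an explicit list of 24 permutations, which the
  simplifier can filter and add up.\<close>

lemma poly_Ch_4:
  "poly (Ch 4 P) x =
    (\<Sum>p\<leftarrow>filter (\<lambda>p. \<forall>s\<in>P. avoids p s) (permutations_of_set_list [1, 2, 3, 4]). x ^ charge p)"
proof -
  have "Av 4 P = set (filter (\<lambda>p. \<forall>s\<in>P. avoids p s) (permutations_of_set_list [1, 2, 3, 4]))"
    unfolding Av_def perms_def permutations_of_set_4 by auto
  moreover have "distinct (permutations_of_set_list [1, 2, 3, 4 :: nat])"
    by (simp add: distinct_permutations_of_set_list)
  ultimately show ?thesis
    by (simp only: poly_Ch sum_list_distinct_conv_sum_set distinct_filter)
qed

section \<open>Effect of inserting one entry on triples, pairs and charge\<close>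

text \<open>The four conjuncts are the ways in which a triple can be cut between \<open>xs\<close>
  and \<open>ys\<close>: 3+0, 0+3, 1+2 and 2+1.\<close>

lemma sorted_wrt3_append:
  "sorted_wrt3 R (xs @ ys) \<longleftrightarrow>
     sorted_wrt3 R xs \<and> sorted_wrt3 R ys \<and> (\<forall>x\<in>set xs. sorted_wrt (R x) ys) \<and>
     (\<forall>z\<in>set ys. sorted_wrt (\<lambda>x y. R x y z) xs)"
  by (induction xs) (auto simp: sorted_wrt_append)

text \<open>Triples without \<open>k\<close> stay as they were; the other conjuncts have
  \<open>k\<close> in first, last and middle position.\<close>

lemma sorted_wrt3_insert:
  "sorted_wrt3 R (xs @ k # ys) \<longleftrightarrow>
     sorted_wrt3 R (xs @ ys) \<and> sorted_wrt (R k) ys \<and> sorted_wrt (\<lambda>x y. R x y k) xs \<and>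
     (\<forall>x\<in>set xs. \<forall>y\<in>set ys. R x k y)"
  by (auto simp: sorted_wrt3_append)

lemma subseq_pair_insert:
  assumes "a \<noteq> k" "b \<noteq> k"
  shows "subseq [a, b] (xs @ k # ys) \<longleftrightarrow> subseq [a, b] (xs @ ys)"
  using assms
  by (induction xs) (auto simp: subseq_Cons_Cons_iff subseq_singleton_left simp del: subseq_Cons2_iff)

lemma subseq_pair_insert_right:
  assumes "k \<notin> set xs" "k \<notin> set ys"
  shows "subseq [a, k] (xs @ k # ys) \<longleftrightarrow> a \<in> set xs \<or> a = k \<and> k \<in> set ys"
  using assms
  by (induction xs) (auto simp: subseq_Cons_Cons_iff subseq_singleton_left
      simp del: subseq_Cons2_iff dest: subseq_pair_set)

text \<open>Inserting a new minimum into a permutation of \<open>{k + 1..n}\<close> needs no relabelling when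
  the length in the charge values is replaced by a fixed \<open>n\<close>.\<close>

definition charge_upto :: "nat \<Rightarrow> nat list \<Rightarrow> nat" where
  "charge_upto n p = (\<Sum>i=2..n. if subseq [i, i - 1] p then n + 1 - i else 0)"

text \<open>Of the pairs of consecutive values, only \<open>Suc k\<close> and \<open>k\<close>
  becomes newly available. It contributes \<open>n + 1 - Suc k = n - k\<close> exactly when
  \<open>Suc k\<close> stands to the left of \<open>k\<close>.\<close>

lemma charge_upto_insert:
  assumes "set (xs @ ys) = {Suc k..n}" "1 \<le> k" "k < n"
  shows "charge_upto n (xs @ k # ys) = charge_upto n (xs @ ys) + (if Suc k \<in> set xs then n - k else 0)"
proof -
  let ?w = "\<lambda>p i. if subseq [i, i - 1] p then n + 1 - i else 0"
  have k: "k \<notin> set (xs @ ys)" "k - 1 \<notin> set (xs @ k # ys)"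
  proof -
    show "k \<notin> set (xs @ ys)" unfolding assms(1) by simp
    \<comment> \<open>For \<open>k = 1\<close> this speaks of the value 0; \<open>1 \<le> k\<close>
      keeps \<open>k - 1\<close> different from \<open>k\<close> despite truncated
      subtraction.\<close>
    have "k - 1 \<notin> set (xs @ ys)" unfolding assms(1) by simp
    then show "k - 1 \<notin> set (xs @ k # ys)" using assms(2) by simp
  qed
  have "?w (xs @ k # ys) i =
      ?w (xs @ ys) i + (if i = Suc k then if Suc k \<in> set xs then n - k else 0 else 0)"
    if "i \<in> {2..n}" for i
  proof -
    consider "i = k" | "i = Suc k" | "i \<noteq> k" "i \<noteq> Suc k" by blast
    then show ?thesis
    proof cases
      case 1
      then have "\<not> subseq [i, i - 1] (xs @ k # ys)" "\<not> subseq [i, i - 1] (xs @ ys)"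
        using k subseq_pair_set[of i "i - 1" "xs @ k # ys"] subseq_pair_set[of i "i - 1" "xs @ ys"]
        by auto
      then show ?thesis using 1 by simp
    next
      case 2
      then have "\<not> subseq [i, i - 1] (xs @ ys)"
        using k(1) subseq_pair_set[of i "i - 1" "xs @ ys"] by auto
      moreover have "subseq [i, i - 1] (xs @ k # ys) \<longleftrightarrow> Suc k \<in> set xs"
        using 2 k(1) subseq_pair_insert_right[of k xs ys "Suc k"] by simp
      ultimately show ?thesis using 2 by simp
    next
      case 3
      have "i - 1 \<noteq> k" using 3 that by auto
      then have "subseq [i, i - 1] (xs @ k # ys) \<longleftrightarrow> subseq [i, i - 1] (xs @ ys)"
        using 3 by (intro subseq_pair_insert)
      then show ?thesis using 3 by (simp only: if_False add_0_right)
    qed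
  qed
  then have "charge_upto n (xs @ k # ys) = charge_upto n (xs @ ys) +
      (\<Sum>i=2..n. if i = Suc k then if Suc k \<in> set xs then n - k else 0 else 0)"
    unfolding charge_upto_def sum.distrib[symmetric] by (rule sum.cong[OF refl])
  also have "(\<Sum>i=2..n. if i = Suc k then if Suc k \<in> set xs then n - k else 0 else 0) =
      (if Suc k \<in> set xs then n - k else 0)"
    using assms(2,3) by (subst sum.delta) auto
  finally show ?thesis .
qed

section \<open>The product formula from two admissible insertions of a minimum\<close>

text \<open>\<open>C xs ys\<close> expresses that a new minimum may be put between \<open>xs\<close> and \<open>ys\<close>.\<close>

locale min_insertion =
  fixes P :: "nat list set" and C :: "nat list \<Rightarrow> nat list \<Rightarrow> bool"
  assumes avoids_insert: "\<And>k xs ys. \<forall>x\<in>set (xs @ ys). k < x \<Longrightarrow>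
      (\<forall>s\<in>P. avoids (xs @ k # ys) s) \<longleftrightarrow> (\<forall>s\<in>P. avoids (xs @ ys) s) \<and> C xs ys"
    and avoids_Nil: "\<And>s. s \<in> P \<Longrightarrow> avoids [] s"
    and C_Nil: "C [] []"
    and two_insertions: "\<And>m u v. distinct (u @ m # v) \<Longrightarrow> \<forall>x\<in>set (u @ v). m < x \<Longrightarrow> C u v \<Longrightarrow>
      \<exists>w ys xs z. {(xs, ys). xs @ ys = u @ m # v \<and> C xs ys} = {(u @ m # w, ys), (xs, z @ m # v)}"
begin

definition avoiders :: "nat \<Rightarrow> nat \<Rightarrow> nat list set" where
  "avoiders n k = {p. set p = {k..n} \<and> distinct p \<and> (\<forall>s\<in>P. avoids p s)}"

definition splits :: "nat list \<Rightarrow> (nat list \<times> nat list) set" where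
  "splits p = {(xs, ys). xs @ ys = p \<and> C xs ys}"

lemma finite_avoiders: "finite (avoiders n k)"
  by (rule finite_subset[OF _ finite_permutations_of_set[of "{k..n}"]])
    (auto simp: avoiders_def permutations_of_set_def)

text \<open>Deleting the minimum \<open>k\<close> leaves an avoider on the larger values together
  with the place where \<open>k\<close> stood; \<open>avoids_insert\<close> makes this
  reversible.\<close>

lemma avoiders_step:
  assumes "k \<le> n"
  shows "avoiders n k = (\<lambda>(xs, ys). xs @ k # ys) ` (\<Union>p\<in>avoiders n (Suc k). splits p)"
    (is "_ = ?f ` ?S")
proof (intro subset_antisym subsetI)
  fix p assume p: "p \<in> avoiders n k"
  then have "k \<in> set p" using assms by (auto simp: avoiders_def)
  then obtain xs ys where [simp]: "p = xs @ k # ys" by (meson split_list)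
  have d: "distinct (xs @ ys)" using p by (auto simp: avoiders_def)
  have "insert k (set (xs @ ys)) = {k..n}" "k \<notin> set (xs @ ys)"
    using p by (auto simp: avoiders_def)
  then have set: "set (xs @ ys) = {Suc k..n}"
    using assms by (metis atLeastAtMost_insertL atLeastAtMost_iff insert_ident not_less_eq_eq order_refl)
  then have "\<forall>x\<in>set (xs @ ys). k < x" by auto
  from avoids_insert[OF this] p d set have "(xs, ys) \<in> ?S"
    by (auto simp: avoiders_def splits_def)
  then show "p \<in> ?f ` ?S" by force
next
  fix p assume "p \<in> ?f ` ?S"
  then obtain xs ys where p: "p = xs @ k # ys" "xs @ ys \<in> avoiders n (Suc k)" "C xs ys"
    by (auto simp: splits_def)
  then have set: "set (xs @ ys) = {Suc k..n}" and d: "distinct (xs @ ys)"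
    by (auto simp: avoiders_def)
  then have "\<forall>x\<in>set (xs @ ys). k < x" by auto
  from avoids_insert[OF this] p have "\<forall>s\<in>P. avoids p s" by (auto simp: avoiders_def)
  moreover have "set p = {k..n}"
    using p(1) set assms atLeastAtMost_insertL[of k n] by auto
  moreover have "distinct p" using p(1) d \<open>\<forall>x\<in>set (xs @ ys). k < x\<close> by auto
  ultimately show "p \<in> avoiders n k" by (simp add: avoiders_def)
qed

text \<open>The two admissible cuts lie on opposite sides of the old minimum \<open>m\<close>, which
  is what decides whether the charge grows.\<close>

lemma splits_eq:
  assumes "p \<in> avoiders n m" "m \<le> n"
  obtains xs ys xs' ys' where "splits p = {(xs, ys), (xs', ys')}" "m \<in> set xs" "m \<notin> set xs'"
proof -
  \<comment> \<open>The list \<open>p\<close> itself arose by an admissible insertion of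
    \<open>m\<close>, and this provides the hypothesis \<open>C u v\<close> of
    \<open>two_insertions\<close>.\<close>
  from assms avoiders_step[OF assms(2)]
  obtain u v where uv: "p = u @ m # v" "u @ v \<in> avoiders n (Suc m)" "C u v"
    by (fastforce simp: splits_def)
  have "distinct (u @ m # v)" using assms uv by (simp add: avoiders_def)
  moreover have "\<forall>x\<in>set (u @ v). m < x" using uv by (auto simp: avoiders_def)
  ultimately obtain w ys xs z where
    s: "{(xs, ys). xs @ ys = u @ m # v \<and> C xs ys} = {(u @ m # w, ys), (xs, z @ m # v)}"
    using two_insertions[OF _ _ uv(3)] by blast
  then have "(xs, z @ m # v) \<in> {(xs, ys). xs @ ys = u @ m # v \<and> C xs ys}" by blast
  then have "(xs @ z) @ m # v = u @ m # v" by simp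
  then have "xs @ z = u" by (simp only: append_same_eq)
  then have "m \<notin> set xs" using \<open>distinct (u @ m # v)\<close> by auto
  with that s uv(1) show ?thesis by (auto simp: splits_def)
qed

text \<open>Each avoider of charge c on the larger values has two extensions, of charges c and c +
  (n - k), whence the factor \<open>1 + q^(n-k)\<close>.\<close>

lemma sum_avoiders_step:
  assumes "1 \<le> k" "k < n"
  shows "(\<Sum>p\<in>avoiders n k. monom 1 (charge_upto n p)) =
    (\<Sum>p\<in>avoiders n (Suc k). monom 1 (charge_upto n p)) * (1 + monom (1::int) (n - k))"
proof -
  let ?f = "\<lambda>(xs, ys). xs @ k # ys" and ?S = "\<Union>p\<in>avoiders n (Suc k). splits p"
  have notin: "k \<notin> set xs \<and> k \<notin> set ys" if "(xs, ys) \<in> ?S" for xs ys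
  proof -
    from that have "set (xs @ ys) = {Suc k..n}" by (auto simp: splits_def avoiders_def)
    then have "k \<notin> set (xs @ ys)" by simp
    then show ?thesis by simp
  qed
  \<comment> \<open>The entry \<open>k\<close> occurs only once in the extended list, so its
    position determines the cut.\<close>
  have "inj_on ?f ?S"
  proof (rule inj_onI, clarify)
    fix xs ys p xs' ys' p'
    assume "p \<in> avoiders n (Suc k)" "(xs, ys) \<in> splits p"
      "p' \<in> avoiders n (Suc k)" "(xs', ys') \<in> splits p'" and eq: "xs @ k # ys = xs' @ k # ys'"
    then have "k \<notin> set xs \<and> k \<notin> set ys" "k \<notin> set xs' \<and> k \<notin> set ys'"
      using notin[of xs ys] notin[of xs' ys'] by blast+
    then show "xs = xs' \<and> ys = ys'" using eq by (simp add: append_Cons_eq_iff)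
  qed
  then have "(\<Sum>p\<in>avoiders n k. monom (1::int) (charge_upto n p)) = (\<Sum>t\<in>?S. monom 1 (charge_upto n (?f t)))"
    by (simp only: avoiders_step[OF less_imp_le[OF assms(2)]] sum.reindex o_def)
  also have "\<dots> = (\<Sum>p\<in>avoiders n (Suc k). \<Sum>t\<in>splits p. monom 1 (charge_upto n (?f t)))"
  proof (rule sum.UNION_disjoint)
    show "\<forall>p\<in>avoiders n (Suc k). finite (splits p)"
    proof
      fix p assume "p \<in> avoiders n (Suc k)"
      then obtain xs ys xs' ys' where "splits p = {(xs, ys), (xs', ys')}"
        using assms(2) by (elim splits_eq[OF _ Suc_leI])
      then show "finite (splits p)" by simp
    qed
    \<comment> \<open>Joining the two halves of a cut gives back the list that was cut, so different
      lists share no cut.\<close>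
    show "\<forall>p\<in>avoiders n (Suc k). \<forall>p'\<in>avoiders n (Suc k). p \<noteq> p' \<longrightarrow> splits p \<inter> splits p' = {}"
      by (auto simp: splits_def)
  qed (rule finite_avoiders)
  also have "\<dots> = (\<Sum>p\<in>avoiders n (Suc k). monom 1 (charge_upto n p) * (1 + monom 1 (n - k)))"
  proof (rule sum.cong)
    fix p assume p: "p \<in> avoiders n (Suc k)"
    obtain xs ys xs' ys' where s: "splits p = {(xs, ys), (xs', ys')}"
      "Suc k \<in> set xs" "Suc k \<notin> set xs'"
      by (rule splits_eq[OF p Suc_leI[OF assms(2)]])
    have "(xs, ys) \<in> splits p" "(xs', ys') \<in> splits p" unfolding s(1) by blast+
    then have eqs: "xs @ ys = p" "xs' @ ys' = p" by (simp_all add: splits_def)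
    have "set p = {Suc k..n}" using p by (simp add: avoiders_def)
    then have "charge_upto n (xs @ k # ys) = charge_upto n p + (n - k)"
      "charge_upto n (xs' @ k # ys') = charge_upto n p"
      using charge_upto_insert[of xs ys k n] charge_upto_insert[of xs' ys' k n] s(2,3) assms
      unfolding eqs by simp_all
    \<comment> \<open>The two cuts are different, so the sum over \<open>splits p\<close> really has
      two terms.\<close>
    moreover have "xs \<noteq> xs'" using s(2,3) by blast
    ultimately show "(\<Sum>t\<in>splits p. monom 1 (charge_upto n (?f t))) =
        monom 1 (charge_upto n p) * (1 + monom (1::int) (n - k))"
      by (simp add: s(1) mult_monom distrib_left)
  qed simp
  finally show ?thesis by (simp add: sum_distrib_right)
qed

text \<open>Downward induction from \<open>k = n\<close>, where \<open>[n]\<close> is the only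
  avoider, its charge is 0 and the product is empty.\<close>

lemma sum_avoiders:
  assumes "1 \<le> k" "k \<le> n"
  shows "(\<Sum>p\<in>avoiders n k. monom 1 (charge_upto n p)) = (\<Prod>i=k..<n. 1 + monom (1::int) (n - i))"
  using assms(2,1)
proof (induction k rule: inc_induct)
  case base
  \<comment> \<open>Viewing \<open>[n]\<close> as an insertion into the empty list makes the locale
    assumptions apply.\<close>
  have "\<forall>s\<in>P. avoids ([] @ n # []) s"
    by (subst avoids_insert) (use avoids_Nil C_Nil in auto)
  then have n: "\<forall>s\<in>P. avoids [n] s" by simp
  have "p = [n]" if p: "set p = {n}" "distinct p" for p
  proof -
    have "length p = Suc 0" using p distinct_card[of p] by simp
    then obtain a where "p = [a]" by (auto simp: length_Suc_conv)
    then show ?thesis using p by simp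
  qed
  with n have "avoiders n n = {[n]}" unfolding avoiders_def by force
  moreover have "charge_upto n [n] = 0"
    unfolding charge_upto_def by (intro sum.neutral) (auto simp: subseq_Cons_Cons_iff simp del: subseq_Cons2_iff)
  ultimately show ?case by simp
next
  case (step k)
  have "(\<Sum>p\<in>avoiders n k. monom 1 (charge_upto n p)) =
      (\<Prod>i=Suc k..<n. 1 + monom (1::int) (n - i)) * (1 + monom 1 (n - k))"
    unfolding sum_avoiders_step[OF step.prems step.hyps(2)] step.IH[OF le_SucI[OF step.prems]] ..
  also have "\<dots> = (\<Prod>i=k..<n. 1 + monom 1 (n - i))"
    unfolding prod.atLeast_Suc_lessThan[OF step.hyps(2)] by (rule mult.commute)
  finally show ?case .
qed

lemma Ch_eq_prod: "Ch n P = (\<Prod>i=1..<n. 1 + monom 1 (n - i))"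
proof (cases "n = 0")
  case True
  \<comment> \<open>The case \<open>n = 0\<close> lies outside the induction; the empty permutation
    alone gives 1, the value of the empty product.\<close>
  have "Av 0 P = {[]}" by (auto simp: Av_def perms_def avoids_Nil)
  then show ?thesis using True by (simp add: Ch_def charge_def)
next
  case False
  have "Av n P = avoiders n 1"
    by (auto simp: Av_def perms_def avoiders_def permutations_of_set_def)
  moreover have "charge p = charge_upto n p" if "p \<in> avoiders n 1" for p
    using that distinct_card[of p] by (simp add: avoiders_def charge_eq charge_upto_def)
  ultimately show ?thesis using sum_avoiders[of 1 n] False by (simp add: Ch_def)
qed

end

section \<open>Constraints that single patterns put on a new minimum\<close>

lemma sorted_wrt_True: "sorted_wrt (\<lambda>_ _. True) xs"
  by (induction xs) auto

text \<open>With \<open>k\<close> below all other entries, a condition on a triple containing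
  \<open>k\<close> becomes a binary one on the other two: \<open>S\<close>, \<open>T\<close> and
  \<open>U\<close> for \<open>k\<close> in first, last and middle place.\<close>

lemma sorted_wrt3_insert_min:
  fixes k :: "'a :: order"
  assumes k: "\<forall>x\<in>set (xs @ ys). k < x"
    and R: "\<And>x y. k < x \<Longrightarrow> k < y \<Longrightarrow> R k x y \<longleftrightarrow> S x y"
      "\<And>x y. k < x \<Longrightarrow> k < y \<Longrightarrow> R x y k \<longleftrightarrow> T x y"
      "\<And>x y. k < x \<Longrightarrow> k < y \<Longrightarrow> R x k y \<longleftrightarrow> U x y"
  shows "sorted_wrt3 R (xs @ k # ys) \<longleftrightarrow>
    sorted_wrt3 R (xs @ ys) \<and> sorted_wrt S ys \<and> sorted_wrt T xs \<and> (\<forall>x\<in>set xs. \<forall>y\<in>set ys. U x y)"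
proof -
  have "sorted_wrt (R k) ys \<longleftrightarrow> sorted_wrt S ys"
    using k R(1) by (auto elim!: sorted_wrt_mono_rel[rotated])
  moreover have "sorted_wrt (\<lambda>x y. R x y k) xs \<longleftrightarrow> sorted_wrt T xs"
    using k R(2) by (auto elim!: sorted_wrt_mono_rel[rotated])
  moreover have "(\<forall>x\<in>set xs. \<forall>y\<in>set ys. R x k y) \<longleftrightarrow> (\<forall>x\<in>set xs. \<forall>y\<in>set ys. U x y)"
    using k R(3) by simp
  ultimately show ?thesis by (simp only: sorted_wrt3_insert)
qed

text \<open>A new minimum can only play the role of 1. The place of 1 in the pattern decides whether
  the entries after \<open>k\<close>, those before it, or pairs across it are constrained.\<close>

lemma avoids_insert_min:
  assumes "\<forall>x\<in>set (xs @ ys). k < x"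
  shows "avoids (xs @ k # ys) [1,3,2] \<longleftrightarrow> avoids (xs @ ys) [1,3,2] \<and> sorted ys"
    and "avoids (xs @ k # ys) [2,1,3] \<longleftrightarrow>
      avoids (xs @ ys) [2,1,3] \<and> (\<forall>x\<in>set xs. \<forall>y\<in>set ys. y \<le> x)"
    and "avoids (xs @ k # ys) [2,3,1] \<longleftrightarrow> avoids (xs @ ys) [2,3,1] \<and> sorted_wrt (\<ge>) xs"
    and "avoids (xs @ k # ys) [3,1,2] \<longleftrightarrow>
      avoids (xs @ ys) [3,1,2] \<and> (\<forall>x\<in>set xs. \<forall>y\<in>set ys. x \<le> y)"
proof -
  show "avoids (xs @ k # ys) [1,3,2] \<longleftrightarrow> avoids (xs @ ys) [1,3,2] \<and> sorted ys"
    unfolding avoids_perms3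
    by (subst sorted_wrt3_insert_min[OF assms,
          where S = "(\<le>)" and T = "\<lambda>_ _. True" and U = "\<lambda>_ _. True"])
      (auto simp: sorted_wrt_True)
  show "avoids (xs @ k # ys) [2,1,3] \<longleftrightarrow>
      avoids (xs @ ys) [2,1,3] \<and> (\<forall>x\<in>set xs. \<forall>y\<in>set ys. y \<le> x)"
    unfolding avoids_perms3
    by (subst sorted_wrt3_insert_min[OF assms,
          where S = "\<lambda>_ _. True" and T = "\<lambda>_ _. True" and U = "(\<ge>)"])
      (auto simp: sorted_wrt_True)
  show "avoids (xs @ k # ys) [2,3,1] \<longleftrightarrow> avoids (xs @ ys) [2,3,1] \<and> sorted_wrt (\<ge>) xs"
    unfolding avoids_perms3
    by (subst sorted_wrt3_insert_min[OF assms,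
          where S = "\<lambda>_ _. True" and T = "(\<ge>)" and U = "\<lambda>_ _. True"])
      (auto simp: sorted_wrt_True)
  show "avoids (xs @ k # ys) [3,1,2] \<longleftrightarrow>
      avoids (xs @ ys) [3,1,2] \<and> (\<forall>x\<in>set xs. \<forall>y\<in>set ys. x \<le> y)"
    unfolding avoids_perms3
    by (subst sorted_wrt3_insert_min[OF assms,
          where S = "\<lambda>_ _. True" and T = "\<lambda>_ _. True" and U = "(\<le>)"])
      (auto simp: sorted_wrt_True)
qed

lemma avoids_Nil_iff: "avoids [] s \<longleftrightarrow> s \<noteq> []"
  by (auto simp: avoids_def order_isomorphic_def)

text \<open>Every cut of \<open>u @ m # v\<close> falls inside \<open>v\<close> or inside
  \<open>u\<close>, so it is enough to find exactly one admissible cut on each side of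
  \<open>m\<close>.\<close>

lemma two_splitsI:
  assumes "v = w0 @ y0" "u = x0 @ z0"
    and right: "\<And>w y. v = w @ y \<Longrightarrow> C (u @ m # w) y \<longleftrightarrow> w = w0 \<and> y = y0"
    and left: "\<And>x z. u = x @ z \<Longrightarrow> C x (z @ m # v) \<longleftrightarrow> x = x0 \<and> z = z0"
  shows "\<exists>w ys xs z. {(xs, ys). xs @ ys = u @ m # v \<and> C xs ys} =
    {(u @ m # w, ys), (xs, z @ m # v)}"
proof (intro exI subset_antisym subsetI)
  fix t
  assume "t \<in> {(xs, ys). xs @ ys = u @ m # v \<and> C xs ys}"
  then obtain xs ys where t: "t = (xs, ys)" "xs @ ys = u @ m # v" "C xs ys" by blast
  then obtain us where "xs = u @ us \<and> us @ ys = m # v \<or> xs @ us = u \<and> ys = us @ m # v"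
    unfolding append_eq_append_conv2 by blast
  then show "t \<in> {(u @ m # w0, y0), (x0, z0 @ m # v)}"
  proof
    assume us: "xs = u @ us \<and> us @ ys = m # v"
    show ?thesis
    proof (cases us)
      \<comment> \<open>The cut directly before \<open>m\<close> counts as a cut on the left
        side.\<close>
      case Nil
      then have "ys = m # v" "xs = u" using us by simp_all
      then show ?thesis using left[of u "[]"] t(1,3) by simp
    next
      case (Cons a w)
      then have "v = w @ ys" "xs = u @ m # w" using us by simp_all
      then show ?thesis using right[of w ys] t(1,3) by simp
    qed
  next
    assume "xs @ us = u \<and> ys = us @ m # v"
    then show ?thesis using left[of xs us] t(1,3) by simp
  qed
next
  fix t
  assume "t \<in> {(u @ m # w0, y0), (x0, z0 @ m # v)}"
  then have "t = (u @ m # w0, y0) \<or> t = (x0, z0 @ m # v)" by blast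
  moreover have "C (u @ m # w0) y0" "C x0 (z0 @ m # v)"
    using right[of w0 y0] left[of x0 z0] assms(1,2) by blast+
  ultimately show "t \<in> {(xs, ys). xs @ ys = u @ m # v \<and> C xs ys}"
    using assms(1,2) by auto
qed

section \<open>The four pairs with the product formula\<close>

text \<open>The new minimum goes to the end or directly before the old minimum \<open>m\<close>: a
  nonempty part behind a cut right of \<open>m\<close> would exceed \<open>m\<close>, and an entry
  between the cut and \<open>m\<close> would create a descent.\<close>

lemma Ch_132_213: "Ch n {[1,3,2], [2,1,3]} = (\<Prod>i=1..<n. 1 + monom 1 (n - i))"
proof -
  interpret min_insertion "{[1,3,2], [2,1,3]}"
    "\<lambda>xs ys. sorted ys \<and> (\<forall>x\<in>set xs. \<forall>y\<in>set ys. y \<le> x)"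
  proof (unfold_locales, goal_cases)
    case (4 m u v)
    note min = 4(2)[unfolded set_append ball_Un] and C = 4(3)
    show ?case
    proof (intro two_splitsI[of v "v" "[]" u "u" "[]"], goal_cases)
      case (3 w y)
      then show ?case using min C
        by (cases y) (auto simp: sorted_wrt_append ball_Un intro: less_imp_le)
    next
      case (4 x z)
      then show ?case using min C
        by (cases z) (auto simp: sorted_wrt_append ball_Un intro: less_imp_le)
    qed simp_all
  qed (auto simp: avoids_insert_min avoids_Nil_iff simp del: One_nat_def)
  show ?thesis by (rule Ch_eq_prod)
qed

text \<open>The two conditions together force all entries before the cut to equal all entries behind
  it, so the new minimum goes to one of the two ends.\<close>

lemma Ch_213_312: "Ch n {[2,1,3], [3,1,2]} = (\<Prod>i=1..<n. 1 + monom 1 (n - i))"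
proof -
  interpret min_insertion "{[2,1,3], [3,1,2]}"
    "\<lambda>xs ys. (\<forall>x\<in>set xs. \<forall>y\<in>set ys. y \<le> x) \<and> (\<forall>x\<in>set xs. \<forall>y\<in>set ys. x \<le> y)"
  proof (unfold_locales, goal_cases)
    case (4 m u v)
    note min = 4(2)[unfolded set_append ball_Un] and C = 4(3)
    show ?case
    proof (intro two_splitsI[of v "v" "[]" u "[]" "u"], goal_cases)
      case (3 w y)
      then show ?case using min C
        by (cases y) (auto simp: sorted_wrt_append ball_Un intro: less_imp_le)
    next
      case (4 x z)
      then show ?case using min C
        by (cases x) (auto simp: sorted_wrt_append ball_Un intro: less_imp_le)
    qed simp_all
  qed (auto simp: avoids_insert_min avoids_Nil_iff simp del: One_nat_def)
  show ?thesis by (rule Ch_eq_prod)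
qed

text \<open>The list decreases up to \<open>m\<close> and increases after it, so the new minimum
  must be adjacent to \<open>m\<close>, on either side.\<close>

lemma Ch_132_231: "Ch n {[1,3,2], [2,3,1]} = (\<Prod>i=1..<n. 1 + monom 1 (n - i))"
proof -
  interpret min_insertion "{[1,3,2], [2,3,1]}"
    "\<lambda>xs ys. sorted ys \<and> sorted_wrt (\<ge>) xs"
  proof (unfold_locales, goal_cases)
    case (4 m u v)
    note min = 4(2)[unfolded set_append ball_Un] and C = 4(3)
    show ?case
    proof (intro two_splitsI[of v "[]" "v" u "u" "[]"], goal_cases)
      case (3 w y)
      then show ?case using min C
        by (cases w) (auto simp: sorted_wrt_append ball_Un intro: less_imp_le)
    next
      case (4 x z)
      then show ?case using min C
        by (cases z) (auto simp: sorted_wrt_append ball_Un intro: less_imp_le)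
    qed simp_all
  qed (auto simp: avoids_insert_min avoids_Nil_iff simp del: One_nat_def)
  show ?thesis by (rule Ch_eq_prod)
qed

text \<open>The new minimum goes to the front or directly after \<open>m\<close>: a nonempty part
  before a cut left of \<open>m\<close> would exceed \<open>m\<close>, and an entry between
  \<open>m\<close> and the cut would create an ascent.\<close>

lemma Ch_231_312: "Ch n {[2,3,1], [3,1,2]} = (\<Prod>i=1..<n. 1 + monom 1 (n - i))"
proof -
  interpret min_insertion "{[2,3,1], [3,1,2]}"
    "\<lambda>xs ys. sorted_wrt (\<ge>) xs \<and> (\<forall>x\<in>set xs. \<forall>y\<in>set ys. x \<le> y)"
  proof (unfold_locales, goal_cases)
    case (4 m u v)
    note min = 4(2)[unfolded set_append ball_Un] and C = 4(3)
    show ?case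
    proof (intro two_splitsI[of v "[]" "v" u "[]" "u"], goal_cases)
      case (3 w y)
      then show ?case using min C
        by (cases w) (auto simp: sorted_wrt_append ball_Un intro: less_imp_le)
    next
      case (4 x z)
      then show ?case using min C
        by (cases x) (auto simp: sorted_wrt_append ball_Un intro: less_imp_le)
    qed simp_all
  qed (auto simp: avoids_insert_min avoids_Nil_iff simp del: One_nat_def)
  show ?thesis by (rule Ch_eq_prod)
qed

section \<open>Separating the classes by values at q = 2\<close>

text \<open>By enumeration. The repeated value 135 is \<open>(1 + 2) * (1 + 4) * (1 + 8)\<close>, in
  accordance with the product formula.\<close>

lemma poly_Ch_4_values:
  "poly (Ch 4 {[1,2,3], [1,3,2]}) 2 = 204"
  "poly (Ch 4 {[1,2,3], [2,1,3]}) 2 = 156"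
  "poly (Ch 4 {[1,2,3], [2,3,1]}) 2 = 152"
  "poly (Ch 4 {[1,2,3], [3,1,2]}) 2 = 200"
  "poly (Ch 4 {[1,3,2], [2,1,3]}) 2 = 135"
  "poly (Ch 4 {[1,3,2], [2,3,1]}) 2 = 135"
  "poly (Ch 4 {[1,3,2], [3,1,2]}) 2 = 185"
  "poly (Ch 4 {[1,3,2], [3,2,1]}) 2 = 35"
  "poly (Ch 4 {[2,1,3], [2,3,1]}) 2 = 95"
  "poly (Ch 4 {[2,1,3], [3,1,2]}) 2 = 135"
  "poly (Ch 4 {[2,1,3], [3,2,1]}) 2 = 23"
  "poly (Ch 4 {[2,3,1], [3,1,2]}) 2 = 135"
  "poly (Ch 4 {[2,3,1], [3,2,1]}) 2 = 39"
  "poly (Ch 4 {[3,1,2], [3,2,1]}) 2 = 51"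
  \<comment> \<open>\<open>One_nat_def\<close> would turn the entry 1 of a pattern into
    \<open>Suc 0\<close>, and the rules \<open>avoids_perms3\<close> would no longer match.\<close>
  by (simp_all add: poly_Ch_4 permutations_of_set_list_def permutations_of_set_aux_list.simps
      avoids_perms3 charge_four del: One_nat_def)

lemma perms_3: "perms 3 = {[1,2,3], [1,3,2], [2,1,3], [2,3,1], [3,1,2], [3,2,1]}"
proof -
  have "{1..3::nat} = set [1, 2, 3]" by auto
  then show ?thesis
    unfolding perms_def
    by (simp only: permutations_of_list) (simp add: permutations_of_set_list_def
        permutations_of_set_aux_list.simps insert_commute)
qed

text \<open>Given as a finite relation, so that membership can be eliminated row by row. The rows
  are the 15 two-element subsets except the excluded one.\<close>

definition charge_table :: "(nat list set \<times> int) set" where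
  "charge_table =
    {({[1,2,3], [1,3,2]}, 204),
     ({[1,2,3], [2,1,3]}, 156),
     ({[1,2,3], [2,3,1]}, 152),
     ({[1,2,3], [3,1,2]}, 200),
     ({[1,3,2], [2,1,3]}, 135),
     ({[1,3,2], [2,3,1]}, 135),
     ({[1,3,2], [3,1,2]}, 185),
     ({[1,3,2], [3,2,1]}, 35),
     ({[2,1,3], [2,3,1]}, 95),
     ({[2,1,3], [3,1,2]}, 135),
     ({[2,1,3], [3,2,1]}, 23),
     ({[2,3,1], [3,1,2]}, 135),
     ({[2,3,1], [3,2,1]}, 39),
     ({[3,1,2], [3,2,1]}, 51)}"

lemma charge_table_complete:
  assumes "P \<in> pattern_pairs"
  shows "(P, poly (Ch 4 P) 2) \<in> charge_table"
proof -
  from assms have P: "P \<subseteq> perms 3" "card P = 2" "P \<noteq> {[1,2,3], [3,2,1]}"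
    by (simp_all add: pattern_pairs_def)
  then obtain x y where xy: "P = {x, y}" "x \<noteq> y" by (meson card_2_iff)
  then have "x \<in> perms 3" "y \<in> perms 3" using P(1) by simp_all
  then have "P \<in> fst ` charge_table"
    using xy(2) P(3) unfolding xy(1) perms_3 charge_table_def image_insert fst_conv
    by (elim insertE emptyE; simp add: doubleton_eq_iff)
  then show ?thesis
    unfolding charge_table_def image_insert fst_conv image_empty
    by (elim insertE emptyE; simp only: poly_Ch_4_values) simp_all
qed

text \<open>The only value found in more than one row is 135, and its four rows are the pairs
  listed.\<close>

lemma charge_table_separates:
  assumes "(P, a) \<in> charge_table" "(Q, a) \<in> charge_table"
  shows "P = Q \<or> P \<in> {{[1,3,2], [2,1,3]}, {[2,1,3], [3,1,2]}, {[1,3,2], [2,3,1]}, {[2,3,1], [3,1,2]}} \<and>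
    Q \<in> {{[1,3,2], [2,1,3]}, {[2,1,3], [3,1,2]}, {[1,3,2], [2,3,1]}, {[2,3,1], [3,1,2]}}"
  using assms unfolding charge_table_def
  by (elim insertE emptyE Pair_inject; simp del: One_nat_def)

lemma four_subset_pattern_pairs:
  "{{[1,3,2], [2,1,3]}, {[2,1,3], [3,1,2]}, {[1,3,2], [2,3,1]}, {[2,3,1], [3,1,2]}} \<subseteq> pattern_pairs"
  by (auto simp: pattern_pairs_def perms_3 doubleton_eq_iff)

theorem theorem2:
  shows "ch_wilf `` {{[1,3,2], [2,1,3]}} =
           {{[1,3,2], [2,1,3]}, {[2,1,3], [3,1,2]}, {[1,3,2], [2,3,1]}, {[2,3,1], [3,1,2]}}
         \<and> (\<forall>P \<in> pattern_pairs -
              {{[1,3,2], [2,1,3]}, {[2,1,3], [3,1,2]}, {[1,3,2], [2,3,1]}, {[2,3,1], [3,1,2]}}.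
              ch_wilf `` {P} = {P})"
proof -
  define K :: "nat list set set" where
    "K = {{[1,3,2], [2,1,3]}, {[2,1,3], [3,1,2]}, {[1,3,2], [2,3,1]}, {[2,3,1], [3,1,2]}}"
  have P0: "{[1,3,2], [2,1,3]} \<in> K"
    unfolding K_def by (rule insertI1)
  have K: "Ch n P = (\<Prod>i=1..<n. 1 + monom 1 (n - i))" if "P \<in> K" for n P
    using that unfolding K_def
    by (elim insertE emptyE) (simp_all only: Ch_132_213 Ch_213_312 Ch_132_231 Ch_231_312)
  \<comment> \<open>Equality for all n is used only at \<open>n = 4\<close>, where the table already
    tells the classes apart.\<close>
  have sep: "P = Q \<or> P \<in> K \<and> Q \<in> K" if "(P, Q) \<in> ch_wilf" for P Q
  proof -
    from that have "P \<in> pattern_pairs" "Q \<in> pattern_pairs" "Ch 4 P = Ch 4 Q"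
      by (simp_all add: ch_wilf_def)
    then show ?thesis
      using charge_table_separates[folded K_def, of P "poly (Ch 4 P) 2" Q]
        charge_table_complete[of P] charge_table_complete[of Q] by simp
  qed
  have refl: "(P, P) \<in> ch_wilf" if "P \<in> pattern_pairs" for P
    using that by (simp add: ch_wilf_def)
  have "(P, Q) \<in> ch_wilf" if "P \<in> K" "Q \<in> K" for P Q
    using four_subset_pattern_pairs[folded K_def] that K[OF that(1)] K[OF that(2)]
    unfolding ch_wilf_def by auto
  then have "ch_wilf `` {{[1,3,2], [2,1,3]}} = K"
    using sep[of "{[1,3,2], [2,1,3]}"] P0 by blast
  moreover have "ch_wilf `` {P} = {P}" if "P \<in> pattern_pairs - K" for P
    using that sep[of P] refl[of P] by blast
  ultimately show ?thesis unfolding K_def by (intro conjI ballI)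
qed

end
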